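(* Let $p$ be an odd prime, $2\le m\le n-1$, $n\ge3$, $1\le t\le p-1$, and let $I$ be the saturated generalized order ideal of $\mathbb{GH}(m,n)$ in which each element of $[m]$ has multiplicity $p-1$, the single upper element $m+1$ has multiplicity $t$, and all other elements have multiplicity $0$, so that \[ I(\mathbb{GP})=(\mathbb{F}_p^m\times0)\cup\{(-1,\dots,-1,j,0,\dots,0):1\le j\le t\}\subseteq\mathbb{F}_p^n \] (with $m$ entries equal to $-1$). Let $D=\mathbb{F}_p^n\setminus I(\mathbb{GP})$. Then $\mathcal{C}_D$ is a Griesmer code with parameters \[ \big[p^n-p^m-t,\ n,\ (p-1)(p^{n-1}-p^{m-1})-t\big]_p . \] Writing $d=(p-1)(p^{n-1}-p^{m-1})-t$ for the minimum distance and $c=p^{n-m-1}$, its nonzero weights and their frequencies (frequencies being added for rows with equal weight) are \[ \begin{array}{ll} \text{weight} & \text{frequency}\\ d & (p-1)c\,\big((p-t+1)p^{m-1}-1\big)\\ d+1 & (p-1)c\,t\,p^{m-1}\\ (p-1)(p^{n-1}-p^{m-1}) & (p^{m-1}-1)c\\ (p-1)p^{n-1}-t & (p-1)c\\ (p-1)p^{n-1} & c-1 \end{array} \] For $t\ge2$ these are five distinct weights if $m\le n-2$ and four if $m=n-1$; for $t=1$ the second and third rows coincide, giving four distinct weights if $m\le n-2$ and three if $m=n-1$. In all cases $\mathcal{C}_D$ is minimal if and only if $m\le n-2$.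
   Context: $[n]=\{1,\dots,n\}$. For $D\subseteq\mathbb{F}_p^n$, $\mathcal{C}_D=\{c_D(u)=(u\cdot x)_{x\in D}:u\in\mathbb{F}_p^n\}$, where $u\cdot x=\sum_i u_ix_i$. An $[N,k,d]_p$ code is a linear code over $\mathbb{F}_p$ of length $N$, dimension $k$, minimum Hamming distance $d$; it is a Griesmer code if $N=\sum_{i=0}^{k-1}\lceil d/p^i\rceil$. A row with frequency $0$ does not contribute a weight. A nonzero codeword $c$ of a linear code $\mathcal{C}$ over $\mathbb{F}_p$ is minimal if $c'\in\mathcal{C}$ and $\mathrm{supp}(c')\subseteq\mathrm{supp}(c)$ imply $c'\in\mathbb{F}_pc$; $\mathcal{C}$ is minimal if all its nonzero codewords are. Generalized order ideals: $[n]_{p-1}$ is the multiset in which each $i\in[n]$ has multiplicity $p-1$. A sub-multiset $J$ is identified with its multiplicity vector $(J_1,\dots,J_n)\in\{0,\dots,p-1\}^n=\mathbb{F}_p^n$; $J\subseteq J'$ means $J_i\le J'_i$ (as integers) for all $i$; $\bar J=\{i:J_i\ne0\}$. The hierarchical poset $\mathbb{H}(m,n)$ on $[n]$ has as its only strict relations $i\prec j$ for all $i\in[m]$, $j\in[n]\setminus[m]$; $\mathbb{GH}(m,n)$ denotes $[n]_{p-1}$ together with this order. $J$ is a saturated generalized order ideal if $\bar J$ is an order ideal (down-closed subset) of $\mathbb{H}(m,n)$ and $J_i=p-1$ whenever $j\in\bar J$ and $i\prec j$. For a saturated generalized order ideal $I$, $I(\mathbb{GP})\subseteq\mathbb{F}_p^n$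 is the set of all saturated generalized order ideals contained in $I$. *)

theory Defs
  imports
    "HOL-Library.Function_Algebras"
    "Jordan_Normal_Form.Matrix"
    "Berlekamp_Zassenhaus.Finite_Field"
begin


text \<open>
  Words whose coordinates are indexed by a finite set \<open>X\<close> (a subset of a type \<open>'i\<close>) are functions
  \<open>'i \<Rightarrow> 'a\<close> that vanish outside \<open>X\<close>.  In this way the space of all words over \<open>X\<close> is a
  linear subspace of the vector space of all functions \<open>'i \<Rightarrow> 'a\<close>, and the library notions of subspace and
  dimension apply to codes.
\<close>

definition word_scale :: "'a::field \<Rightarrow> ('i \<Rightarrow> 'a) \<Rightarrow> 'i \<Rightarrow> 'a" where
  "word_scale a w = (\<lambda>x. a * w x)"

interpretation words: vector_space word_scale
  by unfold_locales (auto simp: word_scale_def fun_eq_iff algebra_simps)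

definition linear_code :: "'i set \<Rightarrow> ('i \<Rightarrow> 'a::field) set \<Rightarrow> bool" where
  "linear_code X C \<longleftrightarrow>
     finite X \<and> (\<forall>w\<in>C. \<forall>x. x \<notin> X \<longrightarrow> w x = 0) \<and> words.subspace C"

definition word_supp :: "('i \<Rightarrow> 'a::zero) \<Rightarrow> 'i set" where
  "word_supp w = {x. w x \<noteq> 0}"

definition hamming_weight :: "('i \<Rightarrow> 'a::zero) \<Rightarrow> nat" where
  "hamming_weight w = card (word_supp w)"

definition hamming_dist :: "('i \<Rightarrow> 'a) \<Rightarrow> ('i \<Rightarrow> 'a) \<Rightarrow> nat" where
  "hamming_dist w w' = card {x. w x \<noteq> w' x}"

text \<open>On \<open>nat\<close>, \<open>Inf\<close> of a nonempty set is its least element.\<close>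

definition min_distance :: "('i \<Rightarrow> 'a) set \<Rightarrow> nat" where
  "min_distance C = Inf {hamming_dist w w' | w w'. w \<in> C \<and> w' \<in> C \<and> w \<noteq> w'}"

text \<open>
  \<open>C\<close> is an \<open>[N, k, d]\<close> code.  The parameters are integers, so that closed formulas for them may
  contain subtractions that are not truncated.
\<close>

definition code_parameters ::
    "'i set \<Rightarrow> ('i \<Rightarrow> 'a::field) set \<Rightarrow> int \<Rightarrow> int \<Rightarrow> int \<Rightarrow> bool" where
  "code_parameters X C N k d \<longleftrightarrow>
     linear_code X C \<and> int (card X) = N \<and> int (words.dim C) = k \<and> int (min_distance C) = d"

definition griesmer_code :: "'i set \<Rightarrow> ('i \<Rightarrow> 'p::prime_card mod_ring) set \<Rightarrow> bool" where
  "griesmer_code X C \<longleftrightarrow>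
     linear_code X C \<and>
     int (card X) = (\<Sum>i<words.dim C. \<lceil>real (min_distance C) / real CARD('p) ^ i\<rceil>)"

definition nonzero_weights :: "('i \<Rightarrow> 'a::zero) set \<Rightarrow> nat set" where
  "nonzero_weights C = hamming_weight ` C - {0}"

definition weight_frequency :: "('i \<Rightarrow> 'a::zero) set \<Rightarrow> nat \<Rightarrow> nat" where
  "weight_frequency C v = card {w \<in> C. hamming_weight w = v}"

definition minimal_codeword :: "('i \<Rightarrow> 'a::field) set \<Rightarrow> ('i \<Rightarrow> 'a) \<Rightarrow> bool" where
  "minimal_codeword C w \<longleftrightarrow>
     w \<in> C \<and> w \<noteq> 0 \<and>
     (\<forall>w'\<in>C. word_supp w' \<subseteq> word_supp w \<longrightarrow> (\<exists>a. w' = word_scale a w))"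

definition minimal_code :: "('i \<Rightarrow> 'a::field) set \<Rightarrow> bool" where
  "minimal_code C \<longleftrightarrow> (\<forall>w\<in>C. w \<noteq> 0 \<longrightarrow> minimal_codeword C w)"

definition eval_word :: "'a::field vec set \<Rightarrow> 'a vec \<Rightarrow> 'a vec \<Rightarrow> 'a" where
  "eval_word D u = (\<lambda>x. if x \<in> D then u \<bullet> x else 0)"

definition defining_set_code :: "nat \<Rightarrow> 'a::field vec set \<Rightarrow> ('a vec \<Rightarrow> 'a) set" where
  "defining_set_code n D = eval_word D ` carrier_vec n"

text \<open>
  Vectors are indexed from \<open>0\<close>: the element \<open>i\<close> of \<open>[n] = {1, \<dots>, n}\<close> is the index \<open>i - 1\<close>, and
  \<open>[m]\<close> becomes \<open>{..<m}\<close>.  A sub-multiset of \<open>[n]\<^bsub>p-1\<^esub>\<close> is identified with its multiplicity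
  vector, an element of \<open>carrier_vec n\<close> over \<open>'p mod_ring\<close>; the multiplicity of an index is the
  representative of the entry in \<open>{0, \<dots>, p - 1}\<close>.
\<close>

definition multiplicity_at :: "'p::prime_card mod_ring vec \<Rightarrow> nat \<Rightarrow> int" where
  "multiplicity_at J i = to_int_mod_ring (J $ i)"

definition submultiset :: "nat \<Rightarrow> 'p::prime_card mod_ring vec \<Rightarrow> 'p mod_ring vec \<Rightarrow> bool" where
  "submultiset n J J' \<longleftrightarrow> (\<forall>i<n. multiplicity_at J i \<le> multiplicity_at J' i)"

definition underlying_set :: "nat \<Rightarrow> 'p::prime_card mod_ring vec \<Rightarrow> nat set" where
  "underlying_set n J = {i. i < n \<and> multiplicity_at J i \<noteq> 0}"

definition hierarchical_less :: "nat \<Rightarrow> nat \<Rightarrow> nat \<Rightarrow> nat \<Rightarrow> bool" where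
  "hierarchical_less m n i j \<longleftrightarrow> i \<in> {..<m} \<and> j \<in> {..<n} - {..<m}"

definition order_ideal :: "nat \<Rightarrow> (nat \<Rightarrow> nat \<Rightarrow> bool) \<Rightarrow> nat set \<Rightarrow> bool" where
  "order_ideal n prec A \<longleftrightarrow> A \<subseteq> {..<n} \<and> (\<forall>j\<in>A. \<forall>i<n. prec i j \<longrightarrow> i \<in> A)"

definition saturated_ideal ::
    "nat \<Rightarrow> (nat \<Rightarrow> nat \<Rightarrow> bool) \<Rightarrow> 'p::prime_card mod_ring vec \<Rightarrow> bool" where
  "saturated_ideal n prec J \<longleftrightarrow>
     J \<in> carrier_vec n \<and>
     order_ideal n prec (underlying_set n J) \<and>
     (\<forall>j\<in>underlying_set n J. \<forall>i<n. prec i j \<longrightarrow> multiplicity_at J i = int CARD('p) - 1)"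

definition ideals_within ::
    "nat \<Rightarrow> (nat \<Rightarrow> nat \<Rightarrow> bool) \<Rightarrow> 'p::prime_card mod_ring vec \<Rightarrow> 'p mod_ring vec set" where
  "ideals_within n prec I = {J. saturated_ideal n prec J \<and> submultiset n J I}"

end

theory Submission
  imports Defs "HOL-Library.Product_Plus"
begin

text \<open>
  For \<open>u \<in> F\<^sub>p\<^sup>n\<close> write \<open>a = u\<^sub>m\<close> and \<open>s = u\<^sub>0 + \<dots> + u\<^bsub>m-1\<^esub>\<close>.  The set \<open>D\<close> is the whole space with the subspace
  \<open>F\<^sub>p\<^sup>m \<times> 0\<close> and the \<open>t\<close> points \<open>(-1, \<dots>, -1, j, 0, \<dots>, 0)\<close> removed.  A linear functional that does not
  vanish on a subspace with \<open>p\<^sup>k\<close> elements is nonzero at \<open>(p - 1) p\<^bsup>k-1\<^esup>\<close> of them, and \<open>u\<close> takes the value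
  \<open>j a - s\<close> at the \<open>j\<close>-th point.  So, for \<open>u \<noteq> 0\<close>, the weight of \<open>c\<^sub>D(u)\<close> is
  \<open>(p - 1) p\<^bsup>n-1\<^esup>\<close>, minus \<open>(p - 1) p\<^bsup>m-1\<^esup>\<close> unless \<open>u\<close> vanishes on the first \<open>m\<close> coordinates, minus the number
  of \<open>j \<in> {1, \<dots>, t}\<close> with \<open>j a \<noteq> s\<close> (\<open>weight_eval_word\<close>).  Since \<open>t < p\<close>, at most one \<open>j\<close> solves \<open>j a = s\<close>
  when \<open>a \<noteq> 0\<close>, and the case distinction by \<open>u\<^sub>0, \<dots>, u\<^bsub>m-1\<^esub>\<close>, \<open>a\<close> and \<open>s\<close> yields the five rows of the table
  (\<open>weight_by_row\<close>).  The frequencies (\<open>card_row\<close>) follow because all fibres of \<open>u \<mapsto> (s, a)\<close> have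
  \<open>p\<^bsup>n-2\<^esup>\<close> elements.

  All these weights are positive, so \<open>u \<mapsto> c\<^sub>D(u)\<close> is injective and the code has dimension \<open>n\<close>.  The Griesmer
  bound is attained: apart from the term \<open>t\<close>, which is lost only at \<open>i = 0\<close>, the sum of the numbers
  \<open>\<lceil>d / p\<^sup>i\<rceil>\<close> is the difference of the geometric sums \<open>p\<^sup>n - 1\<close> and \<open>p\<^sup>m - 1\<close>.

  For \<open>m \<le> n - 2\<close> the smallest and the largest weight satisfy the condition of Ashikhmin and Barg,
  which makes the code minimal (\<open>minimal_code_if_weights_close\<close>).  For \<open>m = n - 1\<close> every vector of \<open>D\<close>
  has a nonzero last coordinate; the word of the last unit vector then has full support and is not
  minimal.
\<close>

section \<open>Weights, minimum distance and minimality of linear codes\<close>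

lemma sum_fun_apply: "(\<Sum>a\<in>A. f a) x = (\<Sum>a\<in>A. f a x)"
  for f :: "'a \<Rightarrow> 'b \<Rightarrow> 'c::comm_monoid_add"
  by (induction A rule: infinite_finite_induct) auto

lemma hamming_dist_eq_weight: "hamming_dist w w' = hamming_weight (w - w')"
  for w w' :: "'i \<Rightarrow> 'a::ab_group_add"
  by (simp add: hamming_dist_def hamming_weight_def word_supp_def)

lemma min_distance_eqI:
  fixes C :: "('i \<Rightarrow> 'a::field) set"
  assumes C: "words.subspace C" and w: "w \<in> C" "w \<noteq> 0" "hamming_weight w = d"
    and least: "\<And>w. w \<in> C \<Longrightarrow> w \<noteq> 0 \<Longrightarrow> d \<le> hamming_weight w"
  shows "min_distance C = d"
  unfolding min_distance_def
proof (rule cInf_eq_minimum)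
  have "d = hamming_dist w 0" "0 \<in> C"
    using w words.subspace_0[OF C] by (auto simp: hamming_dist_eq_weight)
  then show "d \<in> {hamming_dist w w' |w w'. w \<in> C \<and> w' \<in> C \<and> w \<noteq> w'}"
    using w by blast
next
  fix x assume "x \<in> {hamming_dist w w' |w w'. w \<in> C \<and> w' \<in> C \<and> w \<noteq> w'}"
  then obtain v v' where "x = hamming_weight (v - v')" "v \<in> C" "v' \<in> C" "v \<noteq> v'"
    by (auto simp: hamming_dist_eq_weight)
  then show "d \<le> x"
    using least[of "v - v'"] words.subspace_diff[OF C] by auto
qed

text \<open>
  If the support of \<open>w'\<close> is contained in that of \<open>w\<close>, then at each position of \<open>supp w'\<close> exactly one
  of the words \<open>w - a w'\<close> with \<open>a \<noteq> 0\<close> vanishes, and all of them agree with \<open>w\<close> elsewhere.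
\<close>

lemma sum_hamming_weight_pencil:
  fixes w w' :: "'i \<Rightarrow> 'a::{field,finite}"
  assumes fin: "finite (word_supp w)" and sub: "word_supp w' \<subseteq> word_supp w"
  shows "(\<Sum>a\<in>UNIV - {0}. hamming_weight (w - word_scale a w')) + hamming_weight w'
         = (CARD('a) - 1) * hamming_weight w"
proof -
  let ?S = "word_supp w" and ?F = "UNIV - {0::'a}"
  have wt: "hamming_weight (w - word_scale a w') = (\<Sum>x\<in>?S. of_bool (w x \<noteq> a * w' x))" for a
  proof -
    have "word_supp (w - word_scale a w') = {x \<in> ?S. w x \<noteq> a * w' x}"
      using sub by (auto simp: word_supp_def word_scale_def)
    then show ?thesis
      by (simp add: hamming_weight_def fin sum_of_bool_eq Int_def)
  qed
  have col: "(\<Sum>a\<in>?F. of_bool (w x \<noteq> a * w' x)) + of_bool (w' x \<noteq> 0) = CARD('a) - 1"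
    if x: "x \<in> ?S" for x
  proof (cases "w' x = 0")
    case True
    then show ?thesis using x by (simp add: word_supp_def card_Diff_singleton)
  next
    case False
    have "?F \<inter> {a. w x \<noteq> a * w' x} = ?F - {w x / w' x}"
      using False by (auto simp: field_simps)
    moreover have "w x / w' x \<in> ?F"
      using False x by (auto simp: word_supp_def)
    moreover have "card ?F = CARD('a) - 1"
      by (simp add: card_Diff_singleton)
    moreover have "card ?F > 0"
      using \<open>w x / w' x \<in> ?F\<close> by (metis card_gt_0_iff empty_iff finite)
    ultimately show ?thesis
      using False by (simp add: sum_of_bool_eq card_Diff_singleton)
  qed
  have "hamming_weight w' = (\<Sum>x\<in>?S. of_bool (w' x \<noteq> 0))"
  proof -
    have "word_supp w' = {x \<in> ?S. w' x \<noteq> 0}"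
      using sub by (auto simp: word_supp_def)
    then show ?thesis
      by (simp add: hamming_weight_def fin sum_of_bool_eq Int_def)
  qed
  then have "(\<Sum>a\<in>?F. hamming_weight (w - word_scale a w')) + hamming_weight w'
      = (\<Sum>x\<in>?S. (\<Sum>a\<in>?F. of_bool (w x \<noteq> a * w' x)) + of_bool (w' x \<noteq> 0))"
    unfolding wt sum.distrib by (subst sum.swap) simp
  also have "\<dots> = (\<Sum>x\<in>?S. CARD('a) - 1)"
    by (rule sum.cong[OF refl]) (rule col)
  also have "\<dots> = (CARD('a) - 1) * hamming_weight w"
    by (simp add: hamming_weight_def)
  finally show ?thesis .
qed

text \<open>
  The criterion of Ashikhmin and Barg: a linear code whose weights all lie between \<open>wmin\<close> and
  \<open>wmax\<close> with \<open>wmin / wmax > (q - 1) / q\<close> is minimal.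
\<close>

lemma minimal_code_if_weights_close:
  fixes C :: "('i \<Rightarrow> 'a::{field,finite}) set"
  assumes C: "linear_code X C"
    and low: "\<And>w. w \<in> C \<Longrightarrow> w \<noteq> 0 \<Longrightarrow> wmin \<le> hamming_weight w"
    and high: "\<And>w. w \<in> C \<Longrightarrow> w \<noteq> 0 \<Longrightarrow> hamming_weight w \<le> wmax"
    and close: "(CARD('a) - 1) * wmax < CARD('a) * wmin"
  shows "minimal_code C"
  unfolding minimal_code_def minimal_codeword_def
proof (intro ballI impI conjI)
  fix w w' assume w: "w \<in> C" "w \<noteq> 0" and w': "w' \<in> C" "word_supp w' \<subseteq> word_supp w"
  show "\<exists>a. w' = word_scale a w"
  proof (rule ccontr)
    assume neg: "\<nexists>a. w' = word_scale a w"
    have sub: "words.subspace C"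
      using C by (simp add: linear_code_def)
    have "w' \<noteq> 0"
      using neg by (metis words.scale_zero_left)
    have nz: "w - word_scale a w' \<noteq> 0" if "a \<noteq> 0" for a
    proof
      assume "w - word_scale a w' = 0"
      then have "w' = word_scale (inverse a) w"
        using that by (simp add: words.scale_left_imp_eq)
      then show False using neg by blast
    qed
    have "finite (word_supp w)"
      using C w by (auto simp: linear_code_def word_supp_def intro: finite_subset[of _ X])
    note pencil = sum_hamming_weight_pencil[OF this w'(2)]
    have "card (UNIV - {0::'a}) * wmin \<le> (\<Sum>a\<in>UNIV - {0}. hamming_weight (w - word_scale a w'))"
      using nz words.subspace_diff[OF sub w(1) words.subspace_scale[OF sub w'(1)]]
      by (intro sum_bounded_below[of _ wmin, simplified of_nat_id]) (auto intro!: low)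
    moreover have "wmin \<le> hamming_weight w'"
      using low[OF w'(1) \<open>w' \<noteq> 0\<close>] .
    ultimately have "(CARD('a) - 1) * wmin + wmin \<le> (CARD('a) - 1) * hamming_weight w"
      using pencil by (simp add: card_Diff_singleton)
    also have "\<dots> \<le> (CARD('a) - 1) * wmax"
      using high[OF w] by simp
    finally have "CARD('a) * wmin \<le> (CARD('a) - 1) * wmax"
      by (cases "CARD('a)") auto
    then show False using close by simp
  qed
qed auto

section \<open>Codes given by a defining set\<close>

lemma eval_word_add:
  assumes "D \<subseteq> carrier_vec n" "u \<in> carrier_vec n" "v \<in> carrier_vec n"
  shows "eval_word D (u + v) = eval_word D u + eval_word D v"
  using assms by (auto simp: eval_word_def fun_eq_iff add_scalar_prod_distrib[of _ n] subset_iff)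

lemma eval_word_smult:
  assumes "D \<subseteq> carrier_vec n" "u \<in> carrier_vec n"
  shows "eval_word D (a \<cdot>\<^sub>v u) = word_scale a (eval_word D u)"
proof
  fix x show "eval_word D (a \<cdot>\<^sub>v u) x = word_scale a (eval_word D u) x"
    using assms(1) smult_scalar_prod_distrib[OF assms(2), of x a]
    by (auto simp: eval_word_def word_scale_def)
qed

lemma eval_word_zero: "D \<subseteq> carrier_vec n \<Longrightarrow> eval_word D (0\<^sub>v n) = 0"
  by (auto simp: eval_word_def fun_eq_iff subset_iff)

lemma eval_word_minus:
  assumes "D \<subseteq> carrier_vec n" "u \<in> carrier_vec n" "v \<in> carrier_vec n"
  shows "eval_word D (u - v) = eval_word D u - eval_word D v"
  using assms by (auto simp: eval_word_def fun_eq_iff minus_scalar_prod_distrib[of _ n] subset_iff)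

lemma hamming_weight_eval_word:
  "hamming_weight (eval_word D u) = card {x \<in> D. u \<bullet> x \<noteq> 0}"
  by (auto simp: hamming_weight_def word_supp_def eval_word_def intro!: arg_cong[where f = card])

lemma subspace_defining_set_code:
  assumes "D \<subseteq> carrier_vec n"
  shows "words.subspace (defining_set_code n D)"
  unfolding words.subspace_def defining_set_code_def
  using eval_word_add[OF assms, symmetric] eval_word_smult[OF assms, symmetric]
    eval_word_zero[OF assms, symmetric]
  by auto

lemma linear_code_defining_set_code:
  assumes "finite D" "D \<subseteq> carrier_vec n"
  shows "linear_code D (defining_set_code n D)"
  using subspace_defining_set_code[OF assms(2)] assms(1)
  by (auto simp: linear_code_def defining_set_code_def eval_word_def)

lemma eval_word_vec:
  assumes "D \<subseteq> carrier_vec n"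
  shows "eval_word D (vec n a) = (\<Sum>i<n. word_scale (a i) (eval_word D (unit_vec n i)))"
proof
  fix x show "eval_word D (vec n a) x = (\<Sum>i<n. word_scale (a i) (eval_word D (unit_vec n i))) x"
    using assms by (auto simp: sum_fun_apply word_scale_def eval_word_def scalar_prod_def[of "vec n a"]
        lessThan_atLeast0 subset_iff intro!: sum.cong)
qed

lemma dim_defining_set_code:
  fixes D :: "'a::field vec set"
  assumes D: "D \<subseteq> carrier_vec n" and inj: "inj_on (eval_word D) (carrier_vec n)"
  shows "words.dim (defining_set_code n D) = n"
proof -
  let ?e = "\<lambda>i. eval_word D (unit_vec n i)"
  have inj_e: "inj_on ?e {..<n}"
  proof (rule inj_onI)
    fix i j assume ij: "i \<in> {..<n}" "j \<in> {..<n}" "?e i = ?e j"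
    then have "unit_vec n i = (unit_vec n j :: 'a vec)"
      using inj by (auto dest: inj_onD)
    then show "i = j"
      using ij by (metis index_unit_vec(1) index_unit_vec(2) lessThan_iff zero_neq_one)
  qed
  have "words.independent (?e ` {..<n})"
    unfolding words.dependent_finite[OF finite_imageI[OF finite_lessThan]]
  proof (intro notI, elim exE conjE bexE)
    fix a v assume a: "(\<Sum>w\<in>?e ` {..<n}. word_scale (a w) w) = 0"
      and v: "v \<in> ?e ` {..<n}" "a v \<noteq> 0"
    obtain i where i: "i < n" "v = ?e i" using v by auto
    have "eval_word D (vec n (\<lambda>i. a (?e i))) = eval_word D (0\<^sub>v n)"
      using a by (simp add: eval_word_vec[OF D] eval_word_zero[OF D] sum.reindex[OF inj_e])
    then have "vec n (\<lambda>i. a (?e i)) = 0\<^sub>v n"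
      using inj by (auto dest: inj_onD)
    then have "vec n (\<lambda>i. a (?e i)) $ i = 0"
      using i by simp
    then show False using i v by simp
  qed
  moreover have "?e ` {..<n} \<subseteq> defining_set_code n D"
    by (auto simp: defining_set_code_def)
  moreover have "defining_set_code n D \<subseteq> words.span (?e ` {..<n})"
  proof
    fix w assume "w \<in> defining_set_code n D"
    then obtain u where u: "u \<in> carrier_vec n" "w = eval_word D u"
      by (auto simp: defining_set_code_def)
    then have "u = vec n (($) u)" by auto
    then have "w = (\<Sum>i<n. word_scale (u $ i) (?e i))"
      using u eval_word_vec[OF D, of "($) u"] by simp
    then show "w \<in> words.span (?e ` {..<n})"
      by (simp only:) (intro words.span_sum words.span_scale words.span_base imageI)
  qed
  ultimately show ?thesis
    by (intro words.dim_unique) (auto simp: card_image[OF inj_e])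
qed

section \<open>Counting in coordinate subspaces\<close>

text \<open>The vectors of length \<open>n\<close> whose entries outside the index set \<open>S\<close> are zero.\<close>

definition coord_space :: "nat \<Rightarrow> nat set \<Rightarrow> 'a::zero vec set" where
  "coord_space n S = {x \<in> carrier_vec n. \<forall>i<n. i \<notin> S \<longrightarrow> x $ i = 0}"

lemma coord_space_full: "coord_space n {..<n} = carrier_vec n"
  by (auto simp: coord_space_def)

lemma finite_coord_space: "finite (coord_space n S :: 'a::{zero,finite} vec set)"
proof (rule finite_subset)
  show "coord_space n S \<subseteq> vec_of_list ` {xs :: 'a list. set xs \<subseteq> UNIV \<and> length xs = n}"
  proof
    fix x :: "'a vec" assume "x \<in> coord_space n S"
    then show "x \<in> vec_of_list ` {xs. set xs \<subseteq> UNIV \<and> length xs = n}"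
      by (intro image_eqI[of _ _ "list_of_vec x"]) (auto simp: coord_space_def vec_list)
  qed
  show "finite (vec_of_list ` {xs :: 'a list. set xs \<subseteq> UNIV \<and> length xs = n})"
    by (intro finite_imageI finite_lists_length_eq) simp
qed

lemma card_coord_space:
  assumes "S \<subseteq> {..<n}"
  shows "card (coord_space n S :: 'a::{zero,finite} vec set) = CARD('a) ^ card S"
proof -
  have "bij_betw (\<lambda>x. restrict (($) x) S) (coord_space n S :: 'a vec set) (PiE S (\<lambda>_. UNIV))"
  proof (rule bij_betwI[where g = "\<lambda>f. vec n (\<lambda>i. if i \<in> S then f i else 0)"])
    fix x :: "'a vec" assume "x \<in> coord_space n S"
    then show "vec n (\<lambda>i. if i \<in> S then restrict (($) x) S i else 0) = x"
      by (auto simp: coord_space_def)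
  next
    fix f :: "nat \<Rightarrow> 'a" assume f: "f \<in> PiE S (\<lambda>_. UNIV)"
    show "restrict (($) (vec n (\<lambda>i. if i \<in> S then f i else 0))) S = f"
      using f assms by (intro extensionalityI[of _ S]) (auto simp: PiE_def)
  qed (auto simp: coord_space_def)
  then have "card (coord_space n S :: 'a vec set) = card (PiE S (\<lambda>_. UNIV :: 'a set))"
    by (rule bij_betw_same_card)
  then show ?thesis
    by (simp add: card_PiE finite_subset[OF assms])
qed

text \<open>All fibres of a surjective additive map on a coordinate subspace are translates of each other.\<close>

lemma card_fibre_additive:
  fixes f :: "'a::{ab_group_add,finite} vec \<Rightarrow> 'b::{ab_group_add,finite}"
  assumes S: "S \<subseteq> {..<n}"
    and add: "\<And>x y. x \<in> coord_space n S \<Longrightarrow> y \<in> coord_space n S \<Longrightarrow> f (x + y) = f x + f y"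
    and surj: "\<And>b. \<exists>x\<in>coord_space n S. f x = b"
  shows "card {x \<in> coord_space n S. f x = b} * CARD('b) = CARD('a) ^ card S"
proof -
  let ?A = "coord_space n S :: 'a vec set"
  have eq: "card {x \<in> ?A. f x = b'} = card {x \<in> ?A. f x = b}" for b'
  proof -
    obtain y where y: "y \<in> ?A" "f y = b - b'" using surj by blast
    obtain z where z: "z \<in> ?A" "f z = b' - b" "z = - y"
    proof -
      have neg: "- y \<in> ?A" using y by (auto simp: coord_space_def)
      have zero: "0\<^sub>v n \<in> ?A" by (auto simp: coord_space_def)
      have "f (0\<^sub>v n) = 0"
        using add[OF zero zero] by simp
      moreover have "y + - y = 0\<^sub>v n"
        using y by (auto simp: coord_space_def)
      ultimately have "f y + f (- y) = 0"
        using add[OF y(1) neg] by simp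
      then have "f (- y) = b' - b"
        using y by (simp add: algebra_simps add_eq_0_iff)
      then show ?thesis using that neg by blast
    qed
    have closed: "x + x' \<in> ?A" if "x \<in> ?A" "x' \<in> ?A" for x x'
      using that by (auto simp: coord_space_def)
    have "bij_betw (\<lambda>x. x + y) {x \<in> ?A. f x = b'} {x \<in> ?A. f x = b}"
    proof (rule bij_betwI[where g = "\<lambda>x. x + z"])
      show "(\<lambda>x. x + y) \<in> {x \<in> ?A. f x = b'} \<rightarrow> {x \<in> ?A. f x = b}"
        using y closed by (auto simp: add)
      show "(\<lambda>x. x + z) \<in> {x \<in> ?A. f x = b} \<rightarrow> {x \<in> ?A. f x = b'}"
        using z closed by (auto simp: add)
    next
      fix x assume "x \<in> {x \<in> ?A. f x = b'}"
      then show "x + y + z = x" using y z by (auto simp: coord_space_def)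
    next
      fix x assume "x \<in> {x \<in> ?A. f x = b}"
      then show "x + z + y = x" using y z by (auto simp: coord_space_def)
    qed
    then show ?thesis by (rule bij_betw_same_card)
  qed
  have "CARD('a) ^ card S = card (\<Union>b'. {x \<in> ?A. f x = b'})"
  proof -
    have "(\<Union>b'. {x \<in> ?A. f x = b'}) = ?A" by blast
    then show ?thesis using card_coord_space[OF S, where 'a = 'a] by simp
  qed
  also have "\<dots> = (\<Sum>b'\<in>UNIV. card {x \<in> ?A. f x = b'})"
    by (rule card_UN_disjoint) (auto simp: finite_coord_space)
  also have "\<dots> = card {x \<in> ?A. f x = b} * CARD('b)"
    by (subst eq) simp
  finally show ?thesis by simp
qed

lemma card_nonorthogonal_coord_space:
  fixes u :: "'a::{field,finite} vec"
  assumes S: "S \<subseteq> {..<n}" and u: "u \<in> carrier_vec n"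
  shows "int (card {x \<in> coord_space n S. u \<bullet> x \<noteq> 0}) =
    (if \<exists>i\<in>S. u $ i \<noteq> 0 then (int CARD('a) - 1) * int CARD('a) ^ (card S - 1) else 0)"
proof (cases "\<exists>i\<in>S. u $ i \<noteq> 0")
  case True
  then obtain i where i: "i \<in> S" "u $ i \<noteq> 0" by blast
  let ?A = "coord_space n S :: 'a vec set"
  have fib: "card {x \<in> ?A. u \<bullet> x = 0} * CARD('a) = CARD('a) ^ card S"
  proof (rule card_fibre_additive[OF S])
    fix x y assume "x \<in> ?A" "y \<in> ?A"
    then show "u \<bullet> (x + y) = u \<bullet> x + u \<bullet> y"
      using u by (auto simp: coord_space_def intro!: scalar_prod_add_distrib)
  next
    fix b
    have "i < n" using i S by auto
    then have "(b / u $ i) \<cdot>\<^sub>v unit_vec n i \<in> ?A" "u \<bullet> ((b / u $ i) \<cdot>\<^sub>v unit_vec n i) = b"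
      using u i by (auto simp: coord_space_def)
    then show "\<exists>x\<in>?A. u \<bullet> x = b" by blast
  qed
  have "card S > 0"
    using i finite_subset[OF S] by (auto simp: card_gt_0_iff)
  then obtain k where k: "card S = Suc k" by (cases "card S") auto
  have fib': "card {x \<in> ?A. u \<bullet> x = 0} = CARD('a) ^ k"
    using fib k by simp
  have "{x \<in> ?A. u \<bullet> x \<noteq> 0} = ?A - {x \<in> ?A. u \<bullet> x = 0}" by blast
  then have "int (card {x \<in> ?A. u \<bullet> x \<noteq> 0}) = int (card ?A) - int (card {x \<in> ?A. u \<bullet> x = 0})"
    using finite_coord_space[of n S, where 'a = 'a]
    by (simp add: card_Diff_subset card_mono of_nat_diff)
  then show ?thesis
    using True by (simp add: fib' card_coord_space[OF S] k algebra_simps)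
next
  case False
  have "u \<bullet> x = 0" if "x \<in> coord_space n S" for x
    unfolding scalar_prod_def using that False u
    by (intro sum.neutral) (auto simp: coord_space_def)
  then have "{x \<in> coord_space n S. u \<bullet> x \<noteq> 0} = {}" by blast
  then show ?thesis using False by (simp only: card.empty) simp
qed

section \<open>Saturated ideals of the hierarchical order\<close>

lemma to_int_mod_ring_of_nat:
  "j < CARD('p) \<Longrightarrow> to_int_mod_ring (of_nat j :: 'p::prime_card mod_ring) = int j"
  by (simp add: of_nat_of_int_mod_ring)

lemma to_int_mod_ring_bounds:
  "0 \<le> to_int_mod_ring x" "to_int_mod_ring x < int CARD('p)" for x :: "'p::prime_card mod_ring"
  using range_to_int_mod_ring[where 'a = 'p] by (auto simp: set_eq_iff)

lemma uminus_one_mod_ring: "- 1 = (of_nat (CARD('p) - 1) :: 'p::prime_card mod_ring)"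
  by (simp add: of_nat_diff Suc_leI)

lemma to_int_mod_ring_eq_max_iff:
  "to_int_mod_ring x = int CARD('p) - 1 \<longleftrightarrow> x = - 1" for x :: "'p::prime_card mod_ring"
proof -
  have "to_int_mod_ring (- 1 :: 'p mod_ring) = int CARD('p) - 1"
    unfolding uminus_one_mod_ring by (subst to_int_mod_ring_of_nat) (auto simp: of_nat_diff Suc_leI)
  then show ?thesis
    by (metis of_int_mod_ring_to_int_mod_ring)
qed

lemma to_int_mod_ring_eq_0_iff: "to_int_mod_ring x = 0 \<longleftrightarrow> x = 0" for x :: "'p::prime_card mod_ring"
  by (metis of_int_mod_ring_to_int_mod_ring to_int_mod_ring_hom.hom_zero)

lemma of_nat_mod_ring_inj_on: "inj_on (of_nat :: nat \<Rightarrow> 'p::prime_card mod_ring) {..<CARD('p)}"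
proof (rule inj_onI)
  fix i j assume "i \<in> {..<CARD('p)}" "j \<in> {..<CARD('p)}" "of_nat i = (of_nat j :: 'p mod_ring)"
  then have "int i = int j"
    by (metis lessThan_iff to_int_mod_ring_of_nat)
  then show "i = j" by simp
qed

text \<open>
  The saturated ideal that contains exactly one upper element, \<open>m\<close>, with multiplicity \<open>j\<close>:
  saturation forces the multiplicity \<open>p - 1 = -1\<close> on every lower element.
\<close>

definition upper_ideal :: "nat \<Rightarrow> nat \<Rightarrow> nat \<Rightarrow> 'a::ring_1 vec" where
  "upper_ideal n m j = vec n (\<lambda>i. if i < m then - 1 else if i = m then of_nat j else 0)"

lemma saturated_ideal_hierarchical_iff:
  fixes J :: "'p::prime_card mod_ring vec"
  assumes "m \<le> n"
  shows "saturated_ideal n (hierarchical_less m n) J \<longleftrightarrow>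
    J \<in> carrier_vec n \<and> ((\<exists>j. m \<le> j \<and> j < n \<and> J $ j \<noteq> 0) \<longrightarrow> (\<forall>i<m. J $ i = - 1))"
proof -
  have under: "underlying_set n J = {i. i < n \<and> J $ i \<noteq> 0}"
    by (simp add: underlying_set_def multiplicity_at_def to_int_mod_ring_eq_0_iff)
  have "saturated_ideal n (hierarchical_less m n) J \<longleftrightarrow> J \<in> carrier_vec n \<and>
      (\<forall>j\<in>{m..<n}. J $ j \<noteq> 0 \<longrightarrow> (\<forall>i<m. J $ i \<noteq> 0)) \<and>
      (\<forall>j\<in>{m..<n}. J $ j \<noteq> 0 \<longrightarrow> (\<forall>i<m. J $ i = - 1))"
    unfolding saturated_ideal_def order_ideal_def under hierarchical_less_def multiplicity_at_def
      to_int_mod_ring_eq_max_iff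
    using assms by fastforce
  also have "\<dots> \<longleftrightarrow> J \<in> carrier_vec n \<and>
      ((\<exists>j. m \<le> j \<and> j < n \<and> J $ j \<noteq> 0) \<longrightarrow> (\<forall>i<m. J $ i = - 1))"
    by force
  finally show ?thesis .
qed

lemma ideals_within_hierarchical:
  fixes I :: "'p::prime_card mod_ring vec"
  assumes m: "m < n" and t: "t < CARD('p)"
    and low: "\<And>i. i < m \<Longrightarrow> multiplicity_at I i = int CARD('p) - 1"
    and mid: "multiplicity_at I m = int t"
    and high: "\<And>i. m < i \<Longrightarrow> i < n \<Longrightarrow> multiplicity_at I i = 0"
  shows "ideals_within n (hierarchical_less m n) I = coord_space n {..<m} \<union> upper_ideal n m ` {1..t}"
proof (intro equalityI subsetI)
  fix J assume J: "J \<in> ideals_within n (hierarchical_less m n) I"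
  have sat: "saturated_ideal n (hierarchical_less m n) J" and sub: "submultiset n J I"
    using J by (auto simp: ideals_within_def)
  have car: "J \<in> carrier_vec n"
    using sat by (simp add: saturated_ideal_def)
  have zero: "J $ i = 0" if "m < i" "i < n" for i
    using sub that high[OF that] to_int_mod_ring_bounds(1)[of "J $ i"]
      to_int_mod_ring_eq_0_iff[of "J $ i"]
    by (fastforce simp: submultiset_def multiplicity_at_def)
  show "J \<in> coord_space n {..<m} \<union> upper_ideal n m ` {1..t}"
  proof (cases "J $ m = 0")
    case True
    then have "J \<in> coord_space n {..<m}"
      using car zero by (auto simp: coord_space_def) (metis linorder_neqE_nat)
    then show ?thesis by blast
  next
    case False
    define j where "j = nat (to_int_mod_ring (J $ m))"
    have "int j = to_int_mod_ring (J $ m)"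
      using to_int_mod_ring_bounds(1)[of "J $ m"] by (simp add: j_def)
    moreover have "to_int_mod_ring (J $ m) \<noteq> 0"
      using False by (simp add: to_int_mod_ring_eq_0_iff)
    moreover have "to_int_mod_ring (J $ m) \<le> int t"
      using sub m mid by (auto simp: submultiset_def multiplicity_at_def)
    ultimately have j: "1 \<le> j" "j \<le> t"
      by linarith+
    have Jm: "J $ m = of_nat j"
      using \<open>int j = to_int_mod_ring (J $ m)\<close> by (simp add: of_nat_of_int_mod_ring)
    have "\<forall>i<m. J $ i = - 1"
      using sat False m by (auto simp: saturated_ideal_hierarchical_iff)
    then have "J = upper_ideal n m j"
      using car zero Jm by (intro eq_vecI) (auto simp: upper_ideal_def)
    then show ?thesis using j by auto
  qed
next
  fix J :: "'p mod_ring vec"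
  assume "J \<in> coord_space n {..<m} \<union> upper_ideal n m ` {1..t}"
  then show "J \<in> ideals_within n (hierarchical_less m n) I"
  proof
    assume J: "J \<in> coord_space n {..<m}"
    have "multiplicity_at J i \<le> multiplicity_at I i" if "i < n" for i
    proof (cases "i < m")
      case True
      then show ?thesis
        using low[OF True] to_int_mod_ring_bounds(2)[of "J $ i"] by (simp add: multiplicity_at_def)
    next
      case False
      then show ?thesis
        using J that to_int_mod_ring_bounds(1)[of "I $ i"]
        by (simp add: multiplicity_at_def coord_space_def)
    qed
    then show ?thesis
      using J m by (auto simp: ideals_within_def submultiset_def saturated_ideal_hierarchical_iff
          coord_space_def)
  next
    assume "J \<in> upper_ideal n m ` {1..t}"
    then obtain j where j: "j \<in> {1..t}" "J = upper_ideal n m j" by blast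
    have "multiplicity_at J i \<le> multiplicity_at I i" if "i < n" for i
    proof -
      consider "i < m" | "i = m" | "m < i" by linarith
      then show ?thesis
      proof cases
        case 1
        then show ?thesis
          using low[OF 1] to_int_mod_ring_bounds(2)[of "J $ i"] by (simp add: multiplicity_at_def)
      next
        case 2
        then show ?thesis
          using mid j t m by (simp add: multiplicity_at_def upper_ideal_def to_int_mod_ring_of_nat)
      next
        case 3
        then show ?thesis
          using high[OF 3 that] j that by (simp add: multiplicity_at_def upper_ideal_def)
      qed
    qed
    then show ?thesis
      using j m by (auto simp: ideals_within_def submultiset_def saturated_ideal_hierarchical_iff
          upper_ideal_def)
  qed
qed

section \<open>Rounded quotients and geometric sums\<close>

lemma ceiling_divide_eqI:
  fixes x z r k :: int
  assumes "x = k * z - r" "0 \<le> r" "r < k"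
  shows "\<lceil>real_of_int x / real_of_int k\<rceil> = z"
proof -
  have "0 < k" using assms by linarith
  moreover have "real_of_int x = real_of_int k * real_of_int z - real_of_int r"
    using assms(1) by simp
  ultimately have "real_of_int x / real_of_int k = real_of_int z - real_of_int r / real_of_int k"
    by (simp add: field_simps)
  moreover have "0 \<le> real_of_int r / real_of_int k" "real_of_int r / real_of_int k < 1"
    using assms \<open>0 < k\<close> by simp_all
  ultimately show ?thesis
    by (intro ceiling_unique) linarith+
qed

lemma geometric_sum_int: "(\<Sum>i<n. (x - 1) * x ^ (n - 1 - i)) = x ^ n - 1" for x :: int
proof -
  have "(\<Sum>i<n. (x - 1) * x ^ (n - 1 - i)) = (\<Sum>i<n. (x - 1) * x ^ i)"
    using sum.nat_diff_reindex[of "\<lambda>i. (x - 1) * x ^ i" n] by simp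
  then show ?thesis
    by (simp add: power_diff_1_eq sum_distrib_left)
qed

section \<open>The weights of the code\<close>

text \<open>
  The dimensions \<open>m < n\<close> and the number \<open>t\<close> of ideals meeting the upper level are fixed.  The prime
  \<open>p\<close>, the cardinality of the type \<open>'p\<close>, is an integer so that differences are not truncated;
  \<open>prime_type\<close> only records the type.
\<close>

locale one_upper_element =
  fixes n m t :: nat and p :: int and prime_type :: "'p::prime_card itself"
  assumes p [simp]: "int CARD('p) = p"
    and m: "2 \<le> m" "m < n" and t: "1 \<le> t" "t < CARD('p)"
begin

text \<open>The defining set: the complement of \<open>F\<^sub>p\<^sup>m \<times> 0\<close> and of the \<open>t\<close> ideals that meet the upper level.\<close>

definition D :: "'p mod_ring vec set" where
  "D = carrier_vec n - (coord_space n {..<m} \<union> upper_ideal n m ` {1..t})"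

text \<open>The common lower part \<open>(-1, \<dots>, -1, 0, \<dots>, 0)\<close> of the upper ideals has inner product \<open>- low_sum u\<close> with \<open>u\<close>.\<close>

definition low_sum :: "'p mod_ring vec \<Rightarrow> 'p mod_ring" where
  "low_sum u = (\<Sum>i<m. u $ i)"

text \<open>All quantities are written in terms of \<open>p\<close>, \<open>c\<close>, \<open>q = p\<^bsup>m-1\<^esup>\<close> and \<open>t\<close>; \<open>d\<close> turns out to be the minimum distance.\<close>

definition c :: int where "c = p ^ (n - m - 1)"
definition q :: int where "q = p ^ (m - 1)"
definition d :: int where "d = (p - 1) * (p ^ (n - 1) - p ^ (m - 1)) - int t"

lemma pow:
  "p ^ n = p * p * c * q" "p ^ (n - Suc 0) = p * c * q"
  "p ^ m = p * q" "p ^ (m - Suc 0) = q" "p ^ (n - m) = p * c" "p ^ (n - Suc m) = c"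
proof -
  obtain k where k: "n = Suc (m + k)"
    using m less_imp_Suc_add by blast
  obtain l where l: "m = Suc (Suc l)"
    using m by (metis Suc_le_D numeral_2_eq_2 Suc_le_mono)
  have cq: "c = p ^ k" "q = p ^ Suc l"
    unfolding c_def q_def by (simp_all add: k l)
  show "p ^ n = p * p * c * q" "p ^ (n - Suc 0) = p * c * q"
    "p ^ m = p * q" "p ^ (m - Suc 0) = q" "p ^ (n - m) = p * c" "p ^ (n - Suc m) = c"
    unfolding cq unfolding k l by (simp_all add: power_add mult_ac)
qed

lemma d_eq: "d = (p - 1) * (p * c * q - q) - int t"
  by (simp add: d_def pow)

lemma sizes: "2 \<le> p" "p \<le> q" "1 \<le> c" "int t < p" "1 \<le> int t"
proof -
  show p2: "2 \<le> p"
    using prime_ge_2_nat[OF prime_card[where 'a = 'p]] p by linarith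
  have "p ^ 1 \<le> q"
    unfolding q_def using m p2 by (intro power_increasing) auto
  then show "p \<le> q" by simp
  show "1 \<le> c" using p2 by (simp add: c_def)
  show "int t < p" "1 \<le> int t" using t p by linarith+
qed

lemma c_eq_1_iff: "c = 1 \<longleftrightarrow> m = n - 1"
proof (cases "n - m - 1 = 0")
  case True
  then show ?thesis using m by (auto simp: c_def)
next
  case False
  then have "1 < c"
    unfolding c_def using sizes by (intro one_less_power) auto
  then show ?thesis using False m by auto
qed

lemma of_nat_nonzero: "j \<in> {1..t} \<Longrightarrow> (of_nat j :: 'p mod_ring) \<noteq> 0"
  using t of_nat_mod_ring_inj_on[where 'p = 'p, THEN inj_onD, of j 0] by auto

lemma card_one_to [simp]: "card {j. Suc 0 \<le> j \<and> j \<le> k} = k"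
proof -
  have "{j. Suc 0 \<le> j \<and> j \<le> k} = {1..k}" by auto
  then show ?thesis by simp
qed

lemma D_subset: "D \<subseteq> carrier_vec n"
  by (auto simp: D_def)

lemma finite_D: "finite D"
  using finite_coord_space[of n "{..<n}", where 'a = "'p mod_ring"]
  by (simp add: D_def coord_space_full)

lemma inj_upper_ideal: "inj_on (upper_ideal n m :: nat \<Rightarrow> 'p mod_ring vec) {1..t}"
proof (rule inj_onI)
  fix i j assume ij: "i \<in> {1..t}" "j \<in> {1..t}" "upper_ideal n m i = (upper_ideal n m j :: 'p mod_ring vec)"
  then have "upper_ideal n m i $ m = (upper_ideal n m j :: 'p mod_ring vec) $ m" by simp
  then have "of_nat i = (of_nat j :: 'p mod_ring)"
    using m by (simp add: upper_ideal_def)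
  then show "i = j"
    using ij t of_nat_mod_ring_inj_on[where 'p = 'p] by (auto dest: inj_onD)
qed

lemma upper_ideal_notin: 
  assumes "j \<in> {1..t}"
  shows "upper_ideal n m j \<notin> (coord_space n {..<m} :: 'p mod_ring vec set)"
proof
  assume "upper_ideal n m j \<in> (coord_space n {..<m} :: 'p mod_ring vec set)"
  then have "of_nat j = (0 :: 'p mod_ring)"
    using m by (auto simp: coord_space_def upper_ideal_def dest!: spec[of _ m])
  then show False
    using of_nat_nonzero[OF assms] by simp
qed

lemma upper_ideal_carrier: "upper_ideal n m j \<in> carrier_vec n"
  by (simp add: upper_ideal_def)

lemma card_filter_D:
  "int (card {x \<in> D. P x}) = int (card {x \<in> carrier_vec n. P x})
     - int (card {x \<in> coord_space n {..<m}. P x}) - int (card {j \<in> {1..t}. P (upper_ideal n m j)})"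
proof -
  let ?U = "{x \<in> coord_space n {..<m}. P x}" 
    and ?V = "upper_ideal n m ` {j \<in> {1..t}. P (upper_ideal n m j)} :: 'p mod_ring vec set"
  have fin: "finite ?U" "finite ?V"
    by (simp_all add: finite_coord_space)
  have "{x \<in> D. P x} = {x \<in> carrier_vec n. P x} - (?U \<union> ?V)"
    by (auto simp: D_def)
  moreover have "?U \<union> ?V \<subseteq> {x \<in> carrier_vec n. P x}"
    using upper_ideal_carrier by (auto simp: coord_space_def)
  moreover have "finite {x \<in> (carrier_vec n :: 'p mod_ring vec set). P x}"
    using finite_coord_space[of n "{..<n}", where 'a = "'p mod_ring"] by (simp add: coord_space_full)
  ultimately have "int (card {x \<in> D. P x}) = int (card {x \<in> carrier_vec n. P x}) - int (card (?U \<union> ?V))"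
    using fin by (simp add: card_Diff_subset card_mono of_nat_diff)
  also have "card (?U \<union> ?V) = card ?U + card ?V"
    by (rule card_Un_disjoint[OF fin]) (use upper_ideal_notin in auto)
  also have "card ?V = card {j \<in> {1..t}. P (upper_ideal n m j)}"
    by (intro card_image inj_on_subset[OF inj_upper_ideal]) auto
  finally show ?thesis by simp
qed

lemma card_D: "int (card D) = p ^ n - p ^ m - int t"
  using card_filter_D[of "\<lambda>_. True"] m card_coord_space[of "{..<n}" n, where 'a = "'p mod_ring"]
    card_coord_space[of "{..<m}" n, where 'a = "'p mod_ring"]
  by (simp add: coord_space_full)

lemma scalar_prod_upper_ideal:
  assumes u: "u \<in> carrier_vec n"
  shows "u \<bullet> upper_ideal n m j = of_nat j * u $ m - low_sum u"
proof -
  have "u \<bullet> upper_ideal n m j = (\<Sum>i<n. u $ i * upper_ideal n m j $ i)"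
    by (simp add: scalar_prod_def upper_ideal_def lessThan_atLeast0)
  also have "\<dots> = (\<Sum>i<Suc m. u $ i * upper_ideal n m j $ i)"
    using m by (intro sum.mono_neutral_right) (auto simp: upper_ideal_def)
  also have "\<dots> = (\<Sum>i<m. u $ i * upper_ideal n m j $ i) + u $ m * of_nat j"
    using m by (simp add: upper_ideal_def)
  also have "(\<Sum>i<m. u $ i * upper_ideal n m j $ i) = - low_sum u"
    unfolding low_sum_def sum_negf[symmetric]
    using m by (intro sum.cong) (auto simp: upper_ideal_def)
  finally show ?thesis by (simp add: mult.commute)
qed

lemma weight_eval_word:
  assumes u: "u \<in> carrier_vec n"
  shows "int (hamming_weight (eval_word D u)) =
    (if u = 0\<^sub>v n then 0 else (p - 1) * p * c * q) - (if \<forall>i<m. u $ i = 0 then 0 else (p - 1) * q)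
    - int (card {j \<in> {1..t}. of_nat j * u $ m \<noteq> low_sum u})"
proof -
  have z: "u = 0\<^sub>v n \<longleftrightarrow> \<not> (\<exists>i\<in>{..<n}. u $ i \<noteq> 0)"
    using u by auto
  have zm: "(\<forall>i<m. u $ i = 0) \<longleftrightarrow> \<not> (\<exists>i\<in>{..<m}. u $ i \<noteq> 0)"
    by auto
  show ?thesis
    unfolding hamming_weight_eval_word card_filter_D scalar_prod_upper_ideal[OF u] z zm
      coord_space_full[symmetric]
    using m u by (subst (1 2) card_nonorthogonal_coord_space) (auto simp: pow)
qed

text \<open>The row of the weight table to which \<open>c\<^sub>D(u)\<close> belongs, counted from \<open>0\<close>, for \<open>u \<noteq> 0\<close>.\<close>

definition table_row :: "'p mod_ring vec \<Rightarrow> nat" where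
  "table_row u =
    (if \<forall>i<m. u $ i = 0 then (if u $ m = 0 then 4 else 3)
     else if u $ m = 0 then (if low_sum u = 0 then 2 else 0)
     else if \<exists>j\<in>{1..t}. low_sum u = of_nat j * u $ m then 1 else 0)"

lemma table_row_eq_1_iff:
  "table_row u = 1 \<longleftrightarrow>
    \<not> (\<forall>i<m. u $ i = 0) \<and> u $ m \<noteq> 0 \<and> (\<exists>j\<in>{1..t}. low_sum u = of_nat j * u $ m)"
proof -
  have "(if L then (if a then 4 else 3) else if a then (if b then 2 else 0) else if E then 1 else 0)
      = (1::nat) \<longleftrightarrow> \<not> L \<and> \<not> a \<and> E" for L a b E
    by simp
  then show ?thesis unfolding table_row_def .
qed

text \<open>Pairs of a weight and its frequency.  For \<open>t = 1\<close> the rows \<open>1\<close> and \<open>2\<close> have equal weights.\<close>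

definition table :: "(int \<times> int) list" where
  "table =
    [(d, (p - 1) * c * ((p - int t + 1) * p ^ (m - 1) - 1)),
     (d + 1, (p - 1) * c * int t * p ^ (m - 1)),
     ((p - 1) * (p ^ (n - 1) - p ^ (m - 1)), (p ^ (m - 1) - 1) * c),
     ((p - 1) * p ^ (n - 1) - int t, (p - 1) * c),
     ((p - 1) * p ^ (n - 1), c - 1)]"

lemma table_row_less: "table_row u < 5"
  by (simp add: table_row_def)

lemma card_solutions:
  fixes a s :: "'p mod_ring"
  assumes "a \<noteq> 0"
  shows "int (card {j \<in> {1..t}. of_nat j * a \<noteq> s}) =
    int t - (if \<exists>j\<in>{1..t}. s = of_nat j * a then 1 else 0)"
proof (cases "\<exists>j\<in>{1..t}. s = of_nat j * a")
  case True
  then obtain j where j: "j \<in> {1..t}" "s = of_nat j * a" by blast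
  have "{j \<in> {1..t}. of_nat j * a \<noteq> s} = {1..t} - {j}"
    using j assms t of_nat_mod_ring_inj_on[where 'p = 'p] by (auto dest: inj_onD)
  then show ?thesis
    using True j by (simp add: card_Diff_singleton of_nat_diff)
next
  case False
  then have "{j \<in> {1..t}. of_nat j * a \<noteq> s} = {1..t}" by auto
  then show ?thesis using False by simp
qed

lemma table_nth:
  "table ! 0 = ((p - 1) * (p * c * q - q) - int t, (p - 1) * c * ((p - int t + 1) * q - 1))"
  "table ! Suc 0 = ((p - 1) * (p * c * q - q) - int t + 1, (p - 1) * c * int t * q)"
  "table ! 2 = ((p - 1) * (p * c * q - q), (q - 1) * c)"
  "table ! 3 = ((p - 1) * (p * c * q) - int t, (p - 1) * c)"
  "table ! 4 = ((p - 1) * (p * c * q), c - 1)"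
  by (simp_all add: table_def d_def pow)

lemma weight_by_row:
  assumes u: "u \<in> carrier_vec n" "u \<noteq> 0\<^sub>v n"
  shows "int (hamming_weight (eval_word D u)) = fst (table ! table_row u)"
proof -
  define L where "L \<longleftrightarrow> (\<forall>i<m. u $ i = 0)"
  define E where "E \<longleftrightarrow> (\<exists>j\<in>{1..t}. low_sum u = of_nat j * u $ m)"
  have low: "low_sum u = 0" if L
    using that by (simp add: low_sum_def L_def)
  have W: "int (hamming_weight (eval_word D u)) = (p - 1) * p * c * q
      - (if L then 0 else (p - 1) * q) - int (card {j \<in> {1..t}. of_nat j * u $ m \<noteq> low_sum u})"
    using u by (simp only: weight_eval_word L_def if_False)
  have R: "table_row u = (if L then (if u $ m = 0 then 4 else 3)
      else if u $ m = 0 then (if low_sum u = 0 then 2 else 0) else if E then 1 else 0)"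
    by (simp only: table_row_def L_def E_def)
  show ?thesis
  proof (cases "u $ m = 0")
    case True
    then have "card {j \<in> {1..t}. (of_nat j :: 'p mod_ring) * u $ m \<noteq> low_sum u}
        = (if low_sum u = 0 then 0 else t)"
      by simp
    then show ?thesis
      unfolding W R using True low by (cases L) (simp_all add: table_nth algebra_simps)
  next
    case False
    have "\<not> E" if L
      using low[OF that] False of_nat_nonzero by (auto simp: E_def)
    then show ?thesis
      unfolding W R card_solutions[OF False] E_def[symmetric] using False
      by (cases L; cases E) (simp_all add: table_nth algebra_simps)
  qed
qed

section \<open>The frequencies of the weights\<close>

lemma card_fibres:
  fixes P :: "('p mod_ring \<times> 'p mod_ring) set"
  shows "int (card {u \<in> carrier_vec n. (low_sum u, u $ m) \<in> P}) = int (card P) * c * q"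
proof -
  let ?f = "\<lambda>u. (low_sum u, u $ m)"
  have "card {u \<in> coord_space n {..<n}. ?f u = b} * CARD('p mod_ring \<times> 'p mod_ring)
      = CARD('p mod_ring) ^ card {..<n}" for b
  proof (rule card_fibre_additive)
    fix x y :: "'p mod_ring vec"
    assume xy: "x \<in> coord_space n {..<n}" "y \<in> coord_space n {..<n}"
    then have "low_sum (x + y) = low_sum x + low_sum y"
      unfolding low_sum_def sum.distrib[symmetric] using m
      by (intro sum.cong) (auto simp: coord_space_def)
    then show "?f (x + y) = ?f x + ?f y"
      using xy m by (auto simp: coord_space_def)
  next
    fix b :: "'p mod_ring \<times> 'p mod_ring"
    obtain s a where b: "b = (s, a)" by force
    let ?x = "vec n (\<lambda>i. if i = 0 then s else if i = m then a else 0)"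
    have "low_sum ?x = (\<Sum>i<m. if i = 0 then s else 0)"
      unfolding low_sum_def using m by (intro sum.cong) auto
    then have "?f ?x = b"
      using m b by (auto simp: sum.delta)
    moreover have "?x \<in> coord_space n {..<n}"
      by (auto simp: coord_space_def)
    ultimately show "\<exists>x\<in>coord_space n {..<n}. ?f x = b" by blast
  qed auto
  then have "int (card {u \<in> carrier_vec n. ?f u = b} * CARD('p mod_ring \<times> 'p mod_ring))
      = int (CARD('p mod_ring) ^ card {..<n})" for b
    unfolding coord_space_full by (rule arg_cong)
  then have "int (card {u \<in> carrier_vec n. ?f u = b}) * (p * p) = p ^ n" for b
    by simp
  then have fib: "int (card {u \<in> carrier_vec n. ?f u = b}) = c * q" for b
    using sizes by (simp add: pow)
  have "{u \<in> carrier_vec n. ?f u \<in> P} = (\<Union>b\<in>P. {u \<in> carrier_vec n. ?f u = b})" by auto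
  also have "card \<dots> = (\<Sum>b\<in>P. card {u \<in> carrier_vec n. ?f u = b})"
    using finite_coord_space[of n "{..<n}", where 'a = "'p mod_ring"]
    by (intro card_UN_disjoint) (auto simp: coord_space_full)
  finally show ?thesis
    by (simp add: fib)
qed

lemma card_row:
  assumes "k < 5"
  shows "int (card {u \<in> carrier_vec n - {0\<^sub>v n}. table_row u = k}) = snd (table ! k)"
proof -
  let ?K = "\<lambda>k. {u \<in> carrier_vec n - {0\<^sub>v n}. table_row u = k}"
  let ?Z = "coord_space n {m<..<n} :: 'p mod_ring vec set"
  let ?Y = "coord_space n {m..<n} :: 'p mod_ring vec set"
  have fin: "finite (carrier_vec n :: 'p mod_ring vec set)"
    using finite_coord_space[of n "{..<n}", where 'a = "'p mod_ring"] by (simp add: coord_space_full)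
  have cZ: "int (card ?Z) = c"
    by (subst card_coord_space) (auto simp: pow)
  have cY: "int (card ?Y) = p * c"
    by (subst card_coord_space) (auto simp: pow)
  have Z_iff: "u \<in> ?Z \<longleftrightarrow> u \<in> carrier_vec n \<and> (\<forall>i<m. u $ i = 0) \<and> u $ m = 0" for u
    using m by (auto simp: coord_space_def) (metis linorder_neqE_nat)+
  have Y_iff: "u \<in> ?Y \<longleftrightarrow> u \<in> carrier_vec n \<and> (\<forall>i<m. u $ i = 0)" for u
    using m by (auto simp: coord_space_def)
  have low: "low_sum u = 0" if "\<forall>i<m. u $ i = 0" for u
    using that by (simp add: low_sum_def)
  have k4: "int (card (?K 4)) = c - 1"
  proof -
    have "?K 4 = ?Z - {0\<^sub>v n}"
      unfolding set_eq_iff by (auto simp: table_row_def Z_iff split: if_splits)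
    moreover have "0\<^sub>v n \<in> ?Z" by (auto simp: coord_space_def)
    moreover have "card ?Z > 0" using cZ sizes by linarith
    ultimately show ?thesis
      using cZ by (simp add: card_Diff_singleton of_nat_diff)
  qed
  have k3: "int (card (?K 3)) = (p - 1) * c"
  proof -
    have "?K 3 = ?Y - ?Z"
      unfolding set_eq_iff Diff_iff Z_iff Y_iff using m by (auto simp: table_row_def split: if_splits)
    moreover have "?Z \<subseteq> ?Y" unfolding subset_iff Z_iff Y_iff by blast
    ultimately show ?thesis
      using cZ cY by (simp add: card_Diff_subset card_mono of_nat_diff finite_coord_space algebra_simps)
  qed
  have k2: "int (card (?K 2)) = (q - 1) * c"
  proof -
    let ?X = "{u \<in> carrier_vec n. (low_sum u, u $ m) \<in> {(0, 0)}}"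
    have "?K 2 = ?X - ?Z"
      unfolding set_eq_iff Diff_iff Z_iff using m by (auto simp: table_row_def split: if_splits)
    moreover have "?Z \<subseteq> ?X" unfolding subset_iff Z_iff using low by auto
    moreover have "int (card ?X) = c * q" by (subst card_fibres) simp
    ultimately show ?thesis
      using cZ fin
      by (simp add: card_Diff_subset card_mono of_nat_diff finite_coord_space algebra_simps)
  qed
  have k1: "int (card (?K 1)) = (p - 1) * c * int t * q"
  proof -
    let ?g = "\<lambda>(j, a). (of_nat j * a, a) :: 'p mod_ring \<times> 'p mod_ring"
    let ?P = "?g ` ({1..t} \<times> (UNIV - {0}))"
    have "inj_on ?g ({1..t} \<times> (UNIV - {0}))"
      using t of_nat_mod_ring_inj_on[where 'p = 'p] by (auto simp: inj_on_def)
    then have "card ?P = t * (CARD('p) - 1)"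
      by (simp add: card_image card_cartesian_product card_Diff_singleton)
    then have P: "int (card ?P) = int t * (p - 1)"
      using sizes by (simp add: of_nat_diff)
    have "?K 1 = {u \<in> carrier_vec n. (low_sum u, u $ m) \<in> ?P}"
    proof (intro equalityI subsetI)
      fix u assume "u \<in> ?K 1"
      then obtain j where "u \<in> carrier_vec n" "j \<in> {1..t}" "low_sum u = of_nat j * u $ m" "u $ m \<noteq> 0"
        unfolding mem_Collect_eq Diff_iff table_row_eq_1_iff by blast
      then show "u \<in> {u \<in> carrier_vec n. (low_sum u, u $ m) \<in> ?P}"
        by (intro CollectI conjI image_eqI[of _ _ "(j, u $ m)"]) auto
    next
      fix u assume "u \<in> {u \<in> carrier_vec n. (low_sum u, u $ m) \<in> ?P}"
      then obtain x where x: "u \<in> carrier_vec n" "x \<in> {1..t} \<times> (UNIV - {0})"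
        "(low_sum u, u $ m) = ?g x"
        by blast
      obtain j where j: "u \<in> carrier_vec n" "j \<in> {1..t}" "low_sum u = of_nat j * u $ m" "u $ m \<noteq> 0"
        using x by (intro that[of "fst x"]) (auto simp: case_prod_unfold)
      then have "low_sum u \<noteq> 0" using of_nat_nonzero by simp
      then have "\<not> (\<forall>i<m. u $ i = 0)" using low by blast
      moreover from this have "u \<noteq> 0\<^sub>v n" using m by auto
      ultimately show "u \<in> ?K 1"
        using j unfolding mem_Collect_eq Diff_iff table_row_eq_1_iff by blast
    qed
    then show ?thesis
      by (simp only: card_fibres P) simp
  qed
  \<comment> \<open>The remaining row \<open>0\<close> is counted as the complement of the other four.\<close>
  have "carrier_vec n - {0\<^sub>v n} = (\<Union>k<5. ?K k)"
    using table_row_less by auto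
  also have "card \<dots> = (\<Sum>k<5. card (?K k))"
    using fin by (intro card_UN_disjoint) auto
  finally have "(\<Sum>k<5. int (card (?K k))) = int (card (carrier_vec n - {0\<^sub>v n :: 'p mod_ring vec}))"
    by simp
  also have "\<dots> = p ^ n - 1"
    using card_coord_space[of "{..<n}" n, where 'a = "'p mod_ring"]
    by (simp add: coord_space_full card_Diff_singleton of_nat_diff)
  finally have "int (card (?K 0)) = p * p * c * q - 1 - int (card (?K 1)) - int (card (?K 2))
      - int (card (?K 3)) - int (card (?K 4))"
    by (simp add: eval_nat_numeral pow)
  then have k0: "int (card (?K 0)) = (p - 1) * c * ((p - int t + 1) * q - 1)"
    unfolding k1 k2 k3 k4 by (simp add: algebra_simps)
  have "k = 0 \<or> k = 1 \<or> k = 2 \<or> k = 3 \<or> k = 4"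
    using assms by linarith
  then show ?thesis
    using k0 k1 k2 k3 k4 table_nth by auto
qed

section \<open>Parameters, Griesmer bound and minimality of the code\<close>

abbreviation C :: "('p mod_ring vec \<Rightarrow> 'p mod_ring) set" where
  "C \<equiv> defining_set_code n D"

lemma table_weights_order:
  "0 < d" "fst (table ! 0) = d" "fst (table ! Suc 0) = d + 1" "fst (table ! 2) = d + int t"
  "fst (table ! 2) < fst (table ! 3)" "fst (table ! 3) < fst (table ! 4)"
proof -
  have "2 * 1 \<le> p * c"
    using sizes by (intro mult_mono) auto
  then have "1 * 1 \<le> (p - 1) * (p * c - 1)"
    using sizes by (intro mult_mono) auto
  then have "1 * q \<le> (p - 1) * (p * c - 1) * q"
    using sizes by (intro mult_right_mono) auto
  then show "0 < d"
    using sizes by (simp add: d_eq algebra_simps)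
  show "fst (table ! 0) = d" "fst (table ! Suc 0) = d + 1" "fst (table ! 2) = d + int t"
    by (simp_all add: table_nth d_eq)
  have "1 * q \<le> (p - 1) * q"
    using sizes by (intro mult_right_mono) auto
  then have "int t < (p - 1) * q"
    using sizes by linarith
  then show "fst (table ! 2) < fst (table ! 3)"
    by (simp add: table_nth algebra_simps)
  show "fst (table ! 3) < fst (table ! 4)"
    using sizes(5) by (simp add: table_nth)
qed

lemma table_weight_bounds:
  assumes "k < 5"
  shows "d \<le> fst (table ! k)" "fst (table ! k) \<le> (p - 1) * (p * c * q)"
proof -
  have "k = 0 \<or> k = Suc 0 \<or> k = 2 \<or> k = 3 \<or> k = 4"
    using assms by linarith
  moreover have "fst (table ! 4) = (p - 1) * (p * c * q)"
    by (simp add: table_nth)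
  ultimately show "d \<le> fst (table ! k)" "fst (table ! k) \<le> (p - 1) * (p * c * q)"
    using table_weights_order sizes by (elim disjE; simp; linarith)+
qed

lemma table_frequencies:
  "0 < snd (table ! 0)" "0 < snd (table ! Suc 0)" "0 < snd (table ! 2)" "0 < snd (table ! 3)"
  "snd (table ! 4) = c - 1"
proof -
  have "2 * q \<le> (p - int t + 1) * q"
    using sizes by (intro mult_right_mono) auto
  then have "1 < (p - int t + 1) * q"
    using sizes by linarith
  then show "0 < snd (table ! 0)" "0 < snd (table ! Suc 0)" "0 < snd (table ! 2)"
    "0 < snd (table ! 3)" "snd (table ! 4) = c - 1"
    using sizes by (simp_all add: table_nth)
qed

lemma set_table: "set table = {table ! 0, table ! Suc 0, table ! 2, table ! 3, table ! 4}"
  by (simp add: table_def)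

lemma table_nonneg:
  assumes "x \<in> set table"
  shows "0 \<le> snd x" "0 < fst x"
  using assms table_frequencies table_weights_order sizes unfolding set_table by auto

lemma eval_word_nonzero:
  assumes "u \<in> carrier_vec n" "u \<noteq> 0\<^sub>v n"
  shows "eval_word D u \<noteq> 0"
proof
  assume "eval_word D u = 0"
  then have "hamming_weight (eval_word D u) = 0"
    by (simp add: hamming_weight_def word_supp_def)
  then show False
    using weight_by_row[OF assms] table_weight_bounds(1)[OF table_row_less, of u]
      table_weights_order(1)
    by simp
qed

lemma inj_on_eval_word: "inj_on (eval_word D) (carrier_vec n)"
proof (rule inj_onI, rule ccontr)
  fix u v :: "'p mod_ring vec"
  assume uv: "u \<in> carrier_vec n" "v \<in> carrier_vec n" "eval_word D u = eval_word D v" "u \<noteq> v"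
  then have "eval_word D (u - v) = 0"
    by (simp add: eval_word_minus[OF D_subset])
  moreover have "u - v \<noteq> 0\<^sub>v n"
  proof
    assume eq: "u - v = 0\<^sub>v n"
    have "u = v"
    proof (rule eq_vecI)
      fix i assume "i < dim_vec v"
      then have "(u - v) $ i = 0" "i < n" using eq uv by auto
      then show "u $ i = v $ i" using uv by simp
    qed (use uv in auto)
    then show False using uv by simp
  qed
  ultimately show False
    using eval_word_nonzero[of "u - v"] uv by simp
qed

lemma code_word_cases:
  assumes "w \<in> C" "w \<noteq> 0"
  obtains u where "u \<in> carrier_vec n" "u \<noteq> 0\<^sub>v n" "w = eval_word D u"
    "int (hamming_weight w) = fst (table ! table_row u)"
proof -
  obtain u where u: "u \<in> carrier_vec n" "w = eval_word D u"
    using assms by (auto simp: defining_set_code_def)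
  then have "u \<noteq> 0\<^sub>v n"
    using assms eval_word_zero[OF D_subset] by auto
  then show thesis using that u weight_by_row by simp
qed

lemma weight_frequency_code:
  assumes v: "v \<noteq> 0"
  shows "int (weight_frequency C v) = (\<Sum>(w, f)\<leftarrow>table. if w = int v then f else 0)"
proof -
  let ?K = "\<lambda>k. {u \<in> carrier_vec n - {0\<^sub>v n}. table_row u = k}"
  let ?R = "{k \<in> {..<5}. fst (table ! k) = int v}"
  have "{w \<in> C. hamming_weight w = v} = eval_word D ` (\<Union>k\<in>?R. ?K k)"
  proof (intro equalityI subsetI)
    fix w assume w: "w \<in> {w \<in> C. hamming_weight w = v}"
    then have "w \<noteq> 0" using v by (auto simp: hamming_weight_def word_supp_def)
    with w obtain u where "u \<in> carrier_vec n" "u \<noteq> 0\<^sub>v n" "w = eval_word D u"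
      "int (hamming_weight w) = fst (table ! table_row u)"
      using code_word_cases by blast
    then show "w \<in> eval_word D ` (\<Union>k\<in>?R. ?K k)"
      using w table_row_less[of u] by auto
  next
    fix w assume "w \<in> eval_word D ` (\<Union>k\<in>?R. ?K k)"
    then obtain u where u: "u \<in> carrier_vec n" "u \<noteq> 0\<^sub>v n" "fst (table ! table_row u) = int v"
      "w = eval_word D u"
      by auto
    then show "w \<in> {w \<in> C. hamming_weight w = v}"
      using weight_by_row[OF u(1,2)] by (auto simp: defining_set_code_def)
  qed
  then have "weight_frequency C v = card (eval_word D ` (\<Union>k\<in>?R. ?K k))"
    by (simp add: weight_frequency_def)
  also have "\<dots> = card (\<Union>k\<in>?R. ?K k)"
    by (intro card_image inj_on_subset[OF inj_on_eval_word]) auto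
  also have "\<dots> = (\<Sum>k\<in>?R. card (?K k))"
    using finite_coord_space[of n "{..<n}", where 'a = "'p mod_ring"]
    by (intro card_UN_disjoint) (auto simp: coord_space_full)
  finally have "int (weight_frequency C v) = (\<Sum>k\<in>?R. int (card (?K k)))" by simp
  also have "\<dots> = (\<Sum>k\<in>?R. snd (table ! k))"
    by (rule sum.cong[OF refl], rule card_row) simp
  also have "\<dots> = (\<Sum>k<5. if fst (table ! k) = int v then snd (table ! k) else 0)"
    by (rule sum.inter_filter) simp
  also have "\<dots> = (\<Sum>(w, f)\<leftarrow>table. if w = int v then f else 0)"
    by (simp add: sum_list_sum_nth table_def eval_nat_numeral)
  finally show ?thesis .
qed

lemma finite_C: "finite C"
  using finite_coord_space[of n "{..<n}", where 'a = "'p mod_ring"]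
  by (simp add: defining_set_code_def coord_space_full)

lemma nonzero_weights_code: "int ` nonzero_weights C = {w. \<exists>f. (w, f) \<in> set table \<and> f \<noteq> 0}"
proof -
  have occurs: "v \<in> nonzero_weights C \<longleftrightarrow> (\<exists>f. (int v, f) \<in> set table \<and> f \<noteq> 0)" if "v \<noteq> 0" for v
  proof -
    have "v \<in> nonzero_weights C \<longleftrightarrow> {w \<in> C. hamming_weight w = v} \<noteq> {}"
      using that by (auto simp: nonzero_weights_def)
    also have "\<dots> \<longleftrightarrow> int (weight_frequency C v) \<noteq> 0"
      using finite_C by (simp add: weight_frequency_def)
    also have "\<dots> \<longleftrightarrow> (\<exists>x\<in>set (map (\<lambda>(w, f). if w = int v then f else 0) table). x \<noteq> 0)"
      unfolding weight_frequency_code[OF that]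
      by (subst sum_list_nonneg_eq_0_iff) (use table_nonneg(1) in \<open>force\<close>)+
    also have "\<dots> \<longleftrightarrow> (\<exists>f. (int v, f) \<in> set table \<and> f \<noteq> 0)"
      by force
    finally show ?thesis .
  qed
  show ?thesis
  proof (intro equalityI subsetI)
    fix w assume "w \<in> int ` nonzero_weights C"
    then obtain v where "w = int v" "v \<in> nonzero_weights C" by blast
    moreover from this have "v \<noteq> 0" by (simp add: nonzero_weights_def)
    ultimately show "w \<in> {w. \<exists>f. (w, f) \<in> set table \<and> f \<noteq> 0}"
      using occurs by blast
  next
    fix w assume "w \<in> {w. \<exists>f. (w, f) \<in> set table \<and> f \<noteq> 0}"
    then obtain f where f: "(w, f) \<in> set table" "f \<noteq> 0" by blast
    then have "0 < w" using table_nonneg(2) by force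
    then have "int (nat w) = w" "nat w \<noteq> 0" by auto
    then show "w \<in> int ` nonzero_weights C"
      using occurs[of "nat w"] f by (intro image_eqI[of _ _ "nat w"]) auto
  qed
qed

lemma card_nonzero_weights:
  "card (nonzero_weights C) = (if t = 1 then 3 else 4) + (if m = n - 1 then 0 else 1)"
proof -
  let ?w = "\<lambda>k. fst (table ! k)"
  have "{w. \<exists>f. (w, f) \<in> set table \<and> f \<noteq> 0} = fst ` {x \<in> set table. snd x \<noteq> 0}"
    by force
  also have "{x \<in> set table. snd x \<noteq> 0} =
      {table ! 0, table ! Suc 0, table ! 2, table ! 3} \<union> (if c = 1 then {} else {table ! 4})"
    using table_frequencies unfolding set_table by auto
  finally have "{w. \<exists>f. (w, f) \<in> set table \<and> f \<noteq> 0} =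
      {d, d + 1, d + int t, ?w 3} \<union> (if c = 1 then {} else {?w 4})"
    using table_weights_order by auto
  moreover have "card (nonzero_weights C) = card (int ` nonzero_weights C)"
    by (simp add: card_image)
  ultimately have "card (nonzero_weights C) =
      card ({d, d + 1, d + int t, ?w 3} \<union> (if c = 1 then {} else {?w 4}))"
    by (simp only: nonzero_weights_code)
  moreover have "card ({d, d + 1, d + int t, x} \<union> (if c = 1 then {} else {y})) =
      (if t = 1 then 3 else 4) + (if c = 1 then 0 else 1)" if "d + int t < x" "x < y" for x y
  proof (cases "t = 1")
    case True
    then show ?thesis using that by (cases "c = 1") (simp_all add: card_insert_if)
  next
    case False
    then have "1 < t" using t by simp
    then show ?thesis using that by (cases "c = 1") (simp_all add: card_insert_if)
  qed
  moreover have "d + int t < ?w 3" "?w 3 < ?w 4"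
    using table_weights_order by simp_all
  ultimately show ?thesis
    by (simp only: c_eq_1_iff)
qed

lemma min_distance_code: "int (min_distance C) = d"
proof -
  have "{u \<in> carrier_vec n - {0\<^sub>v n}. table_row u = 0} \<noteq> {}"
    using card_row[of 0] table_frequencies(1) by (metis card.empty of_nat_0 zero_less_numeral less_irrefl)
  then obtain u where u: "u \<in> carrier_vec n" "u \<noteq> 0\<^sub>v n" "table_row u = 0" by blast
  have "min_distance C = nat d"
  proof (rule min_distance_eqI[OF subspace_defining_set_code[OF D_subset]])
    show "eval_word D u \<in> C" using u by (simp add: defining_set_code_def)
    show "eval_word D u \<noteq> 0" using eval_word_nonzero u by blast
    show "hamming_weight (eval_word D u) = nat d"
      using weight_by_row[OF u(1,2)] u(3) table_weights_order(2) by simp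
  next
    fix w assume "w \<in> C" "w \<noteq> 0"
    then obtain u where "int (hamming_weight w) = fst (table ! table_row u)"
      using code_word_cases by blast
    then show "nat d \<le> hamming_weight w"
      using table_weight_bounds(1)[OF table_row_less, of u] by linarith
  qed
  then show ?thesis using table_weights_order(1) by simp
qed

lemma linear_code_C: "linear_code D C"
  by (rule linear_code_defining_set_code[OF finite_D D_subset])

lemma dim_code: "words.dim C = n"
  by (rule dim_defining_set_code[OF D_subset inj_on_eval_word])

text \<open>
  For \<open>i \<ge> m\<close> the subtracted amount \<open>(p - 1) q + t\<close> is smaller than \<open>p\<^sup>m\<close> because \<open>t < p \<le> q\<close>, so rounding up
  removes it altogether.
\<close>

lemma griesmer_term:
  assumes i: "i < n"
  shows "\<lceil>real_of_int d / real_of_int p ^ i\<rceil> = (p - 1) * p ^ (n - 1 - i)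
    - (if i < m then (p - 1) * p ^ (m - 1 - i) else 0) - (if i = 0 then int t else 0)"
proof -
  have n1: "p ^ (n - 1) = p ^ i * p ^ (n - 1 - i)"
    using i by (simp flip: power_add)
  have m1: "p ^ (m - 1) = p ^ i * p ^ (m - 1 - i)" if "i < m"
    using that by (simp flip: power_add)
  consider "i = 0" | "0 < i" "i < m" | "m \<le> i" by linarith
  then have "\<lceil>real_of_int d / real_of_int (p ^ i)\<rceil> = (p - 1) * p ^ (n - 1 - i)
    - (if i < m then (p - 1) * p ^ (m - 1 - i) else 0) - (if i = 0 then int t else 0)"
  proof cases
    case 1
    then have "\<lceil>real_of_int d / real_of_int (p ^ i)\<rceil> = d" by simp
    then show ?thesis using 1 m by (simp only:) (simp add: d_def right_diff_distrib)
  next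
    case 2
    have "p ^ 1 \<le> p ^ i"
      using 2 sizes by (intro power_increasing) auto
    then have "int t < p ^ i"
      using sizes by simp
    then show ?thesis
      using 2 by (intro ceiling_divide_eqI[where r = "int t"])
        (simp_all add: d_def n1 m1 right_diff_distrib mult_ac del: One_nat_def)
  next
    case 3
    have "(p - 1) * q + int t < p ^ m"
      using sizes by (simp add: pow algebra_simps)
    also have "\<dots> \<le> p ^ i"
      using 3 sizes by (intro power_increasing) auto
    finally have "(p - 1) * q + int t < p ^ i" .
    then show ?thesis
      using 3 m sizes by (intro ceiling_divide_eqI[where r = "(p - 1) * q + int t"])
        (simp_all add: d_def n1 q_def right_diff_distrib mult_ac del: One_nat_def)
  qed
  then show ?thesis by simp
qed

lemma griesmer_code_C: "griesmer_code D C"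
proof -
  have "(\<Sum>i<n. \<lceil>real_of_int d / real_of_int p ^ i\<rceil>) =
      (\<Sum>i<n. (p - 1) * p ^ (n - 1 - i) - (if i < m then (p - 1) * p ^ (m - 1 - i) else 0)
        - (if i = 0 then int t else 0))"
    by (rule sum.cong[OF refl]) (simp only: griesmer_term lessThan_iff)
  also have "\<dots> = (p ^ n - 1) - (\<Sum>i<n. if i < m then (p - 1) * p ^ (m - 1 - i) else 0) - int t"
    using m by (simp only: sum_subtractf geometric_sum_int) simp
  also have "(\<Sum>i<n. if i < m then (p - 1) * p ^ (m - 1 - i) else 0) =
      (\<Sum>i<m. (p - 1) * p ^ (m - 1 - i))"
    using m by (intro sum.mono_neutral_cong_right) auto
  also have "\<dots> = p ^ m - 1" by (rule geometric_sum_int)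
  finally have "(\<Sum>i<n. \<lceil>real_of_int d / real_of_int p ^ i\<rceil>) = int (card D)"
    by (simp add: card_D)
  moreover have "real (min_distance C) = real_of_int d"
    using min_distance_code by (metis of_int_of_nat_eq)
  moreover have "real CARD('p) = real_of_int p"
    using p by (metis of_int_of_nat_eq)
  ultimately show ?thesis
    unfolding griesmer_code_def dim_code using linear_code_C by simp
qed

lemma minimal_code_if_codim_ge_2:
  assumes "m \<noteq> n - 1"
  shows "minimal_code C"
proof (rule minimal_code_if_weights_close[OF linear_code_C])
  fix w assume w: "w \<in> C" "w \<noteq> 0"
  then obtain u where "int (hamming_weight w) = fst (table ! table_row u)"
    using code_word_cases by blast
  then show "nat d \<le> hamming_weight w" "hamming_weight w \<le> nat ((p - 1) * (p * c * q))"
    using table_weight_bounds[OF table_row_less, of u] by linarith+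
next
  \<comment> \<open>\<open>p d - (p - 1) ((p - 1) p\<^bsup>n-1\<^esup>) = p ((p - 1) (c - 1) q - t)\<close>, and \<open>c \<ge> 2\<close>.\<close>
  have "2 \<le> c"
    using assms c_eq_1_iff sizes by linarith
  then have "1 * 1 \<le> (p - 1) * (c - 1)"
    using sizes by (intro mult_mono) auto
  then have "1 * q \<le> ((p - 1) * (c - 1)) * q"
    using sizes by (intro mult_right_mono) auto
  then have "0 < ((p - 1) * (c - 1)) * q - int t"
    using sizes by linarith
  then have "0 < p * (((p - 1) * (c - 1)) * q - int t)"
    using sizes by simp
  then have "(p - 1) * ((p - 1) * (p * c * q)) < p * d"
    by (simp add: d_eq algebra_simps)
  moreover have "0 \<le> (p - 1) * (p * c * q)" "0 \<le> d"
    using sizes table_weights_order(1) by auto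
  ultimately have "int ((CARD('p) - 1) * nat ((p - 1) * (p * c * q))) < int (CARD('p) * nat d)"
    by (simp add: of_nat_diff Suc_leI)
  then show "(CARD('p mod_ring) - 1) * nat ((p - 1) * (p * c * q)) < CARD('p mod_ring) * nat d"
    unfolding CARD_mod_ring of_nat_less_iff .
qed

lemma not_minimal_code_if_codim_1:
  assumes "m = n - 1"
  shows "\<not> minimal_code C"
proof
  assume min: "minimal_code C"
  let ?e = "unit_vec n m :: 'p mod_ring vec" and ?e' = "unit_vec n 0 :: 'p mod_ring vec"
  have e: "?e \<in> carrier_vec n" "?e' \<in> carrier_vec n" "?e \<noteq> 0\<^sub>v n"
    using m by (auto dest: arg_cong[where f = "\<lambda>x. x $ m"])
  \<comment> \<open>The vectors with last coordinate zero form the subspace removed from \<open>D\<close>.\<close>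
  have "x $ m \<noteq> 0" if x: "x \<in> D" for x
  proof
    assume "x $ m = 0"
    moreover have "i = m" if "i < n" "\<not> i < m" for i
      using that assms by linarith
    ultimately have "x \<in> coord_space n {..<m}"
      using x D_subset by (auto simp: coord_space_def)
    then show False using x by (simp add: D_def)
  qed
  then have "word_supp (eval_word D ?e) = D"
    using D_subset m by (auto simp: word_supp_def eval_word_def subset_iff)
  moreover have "word_supp (eval_word D ?e') \<subseteq> D"
    by (auto simp: word_supp_def eval_word_def)
  moreover have "minimal_codeword C (eval_word D ?e)"
    using min e eval_word_nonzero by (auto simp: minimal_code_def defining_set_code_def)
  moreover have "eval_word D ?e' \<in> C"
    using e by (auto simp: defining_set_code_def)
  ultimately obtain a where "eval_word D ?e' = word_scale a (eval_word D ?e)"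
    by (auto simp: minimal_codeword_def)
  then have "eval_word D ?e' = eval_word D (a \<cdot>\<^sub>v ?e)"
    using eval_word_smult[OF D_subset e(1)] by simp
  then have "?e' = a \<cdot>\<^sub>v ?e"
    using inj_on_eval_word e by (auto dest: inj_onD)
  then have "?e' $ 0 = (a \<cdot>\<^sub>v ?e) $ 0" by simp
  then show False using m by simp
qed

end

section \<open>The complement of the saturated ideals as a defining set\<close>

theorem theorem4p4:
  fixes p m n t :: nat
    and I :: "'p::prime_card mod_ring vec"
    and D :: "'p mod_ring vec set"
    and C :: "('p mod_ring vec \<Rightarrow> 'p mod_ring) set"
    and d c :: int
    and rows :: "(int \<times> int) list"
  assumes p: "p = CARD('p)" "odd p"
    and mn: "2 \<le> m" "m \<le> n - 1" "3 \<le> n"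
    and t: "1 \<le> t" "t \<le> p - 1"
    and I: "I \<in> carrier_vec n"
      "\<And>i. i < m \<Longrightarrow> multiplicity_at I i = int p - 1"
      "multiplicity_at I m = int t"
      "\<And>i. m < i \<Longrightarrow> i < n \<Longrightarrow> multiplicity_at I i = 0"
    and D: "D = carrier_vec n - ideals_within n (hierarchical_less m n) I"
    and C: "C = defining_set_code n D"
    and d: "d = (int p - 1) * (int p ^ (n - 1) - int p ^ (m - 1)) - int t"
    and c: "c = int p ^ (n - m - 1)"
    and rows: "rows =
      [(d, (int p - 1) * c * ((int p - int t + 1) * int p ^ (m - 1) - 1)),
       (d + 1, (int p - 1) * c * int t * int p ^ (m - 1)),
       ((int p - 1) * (int p ^ (n - 1) - int p ^ (m - 1)), (int p ^ (m - 1) - 1) * c),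
       ((int p - 1) * int p ^ (n - 1) - int t, (int p - 1) * c),
       ((int p - 1) * int p ^ (n - 1), c - 1)]"
  shows
    "saturated_ideal n (hierarchical_less m n) I \<and>
     ideals_within n (hierarchical_less m n) I =
       {x \<in> carrier_vec n. \<forall>i. m \<le> i \<and> i < n \<longrightarrow> x $ i = 0} \<union>
       {vec n (\<lambda>i. if i < m then - 1 else if i = m then of_nat j else 0) | j. 1 \<le> j \<and> j \<le> t} \<and>
     griesmer_code D C \<and>
     code_parameters D C (int p ^ n - int p ^ m - int t) (int n) d \<and>
     (\<forall>v::nat. v \<noteq> 0 \<longrightarrow>
       int (weight_frequency C v) = (\<Sum>(w, f)\<leftarrow>rows. if w = int v then f else 0)) \<and>
     int ` nonzero_weights C = {w. \<exists>f. (w, f) \<in> set rows \<and> f \<noteq> 0} \<and>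
     (2 \<le> t \<and> m \<le> n - 2 \<longrightarrow> card (nonzero_weights C) = 5) \<and>
     (2 \<le> t \<and> m = n - 1 \<longrightarrow> card (nonzero_weights C) = 4) \<and>
     (t = 1 \<longrightarrow> d + 1 = (int p - 1) * (int p ^ (n - 1) - int p ^ (m - 1))) \<and>
     (t = 1 \<and> m \<le> n - 2 \<longrightarrow> card (nonzero_weights C) = 4) \<and>
     (t = 1 \<and> m = n - 1 \<longrightarrow> card (nonzero_weights C) = 3) \<and>
     (minimal_code C \<longleftrightarrow> m \<le> n - 2)"
proof -
  have mn': "m < n" "m \<le> n - 2 \<longleftrightarrow> m \<noteq> n - 1"
    using mn by auto
  have tp: "t < CARD('p)"
    using t p zero_less_card_finite[where 'a = 'p] by simp
  have entries: "I $ i = - 1" if "i < m" for i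
    using I(2)[OF that] p(1) by (simp add: multiplicity_at_def to_int_mod_ring_eq_max_iff)
  have sat: "saturated_ideal n (hierarchical_less m n) I"
    using I(1) entries mn'(1) by (simp add: saturated_ideal_hierarchical_iff)
  have ideals: "ideals_within n (hierarchical_less m n) I = coord_space n {..<m} \<union> upper_ideal n m ` {1..t}"
    by (rule ideals_within_hierarchical[OF mn'(1) tp I(2)[unfolded p(1)] I(3) I(4)])
  have "coord_space n {..<m} = {x \<in> carrier_vec n. \<forall>i. m \<le> i \<and> i < n \<longrightarrow> x $ i = (0 :: 'p mod_ring)}"
    by (auto simp: coord_space_def)
  moreover have "upper_ideal n m ` {1..t} =
      {vec n (\<lambda>i. if i < m then - 1 else if i = m then of_nat j else 0 :: 'p mod_ring) | j. 1 \<le> j \<and> j \<le> t}"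
    by (auto simp: upper_ideal_def)
  ultimately have ideals_explicit: "ideals_within n (hierarchical_less m n) I =
       {x \<in> carrier_vec n. \<forall>i. m \<le> i \<and> i < n \<longrightarrow> x $ i = 0} \<union>
       {vec n (\<lambda>i. if i < m then - 1 else if i = m then of_nat j else 0) | j. 1 \<le> j \<and> j \<le> t}"
    using ideals by simp
  interpret H: one_upper_element n m t "int p" "TYPE('p)"
    using p(1) mn(1) mn'(1) t(1) tp by unfold_locales simp_all
  have D_eq: "D = H.D"
    unfolding D H.D_def ideals ..
  have C_eq: "C = H.C"
    unfolding C D_eq ..
  have d_eq: "d = H.d"
    unfolding d H.d_def ..
  have rows_eq: "rows = H.table"
    unfolding rows H.table_def c d_eq H.c_def ..
  have params: "code_parameters D C (int p ^ n - int p ^ m - int t) (int n) d"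
    unfolding code_parameters_def D_eq C_eq d_eq
    using H.linear_code_C H.card_D H.dim_code H.min_distance_code by simp
  have minimal: "minimal_code C \<longleftrightarrow> m \<le> n - 2"
    unfolding C_eq mn'(2) using H.minimal_code_if_codim_ge_2 H.not_minimal_code_if_codim_1 by blast
  have frequencies: "\<forall>v::nat. v \<noteq> 0 \<longrightarrow>
      int (weight_frequency C v) = (\<Sum>(w, f)\<leftarrow>rows. if w = int v then f else 0)"
    unfolding C_eq rows_eq using H.weight_frequency_code by blast
  have weights: "int ` nonzero_weights C = {w. \<exists>f. (w, f) \<in> set rows \<and> f \<noteq> 0}"
    unfolding C_eq rows_eq by (rule H.nonzero_weights_code)
  have number: "card (nonzero_weights C) = (if t = 1 then 3 else 4) + (if m = n - 1 then 0 else 1)"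
    unfolding C_eq by (rule H.card_nonzero_weights)
  have griesmer: "griesmer_code D C"
    unfolding D_eq C_eq by (rule H.griesmer_code_C)
  have coincide: "t = 1 \<longrightarrow> d + 1 = (int p - 1) * (int p ^ (n - 1) - int p ^ (m - 1))"
    unfolding d by simp
  have counts: "2 \<le> t \<and> m \<le> n - 2 \<longrightarrow> card (nonzero_weights C) = 5"
    "2 \<le> t \<and> m = n - 1 \<longrightarrow> card (nonzero_weights C) = 4"
    "t = 1 \<and> m \<le> n - 2 \<longrightarrow> card (nonzero_weights C) = 4"
    "t = 1 \<and> m = n - 1 \<longrightarrow> card (nonzero_weights C) = 3"
    unfolding mn'(2) number by auto
  show ?thesis
    by (intro conjI sat ideals_explicit griesmer params frequencies weights counts coincide minimal)
qed

end
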